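(* For every $z\in U$ and every $n\ge1$, if $T^n(z)\ne0$, then $|q_n(z)|<|q_{n+1}(z)|$.
   Context: Let $\zeta=\frac{1+\sqrt{-3}}2$, $\eta=\frac{3+\sqrt{-3}}2$, $\mathfrak o(\sqrt{-3})=\mathbb Z+\mathbb Z\zeta$, $\mathcal J=\eta\cdot\mathfrak o(\sqrt{-3})$. $U$ is the fundamental domain of $\mathbb C/\mathcal J$ consisting of the open regular hexagon with vertices $\zeta^k$ ($0\le k\le 5$), together with the three open sides $\{t\zeta+(1-t)(-\overline\zeta):0<t<1\}$, $\{t(-\zeta)+(1-t)(-1):0<t<1\}$, $\{t+(1-t)\overline\zeta:0<t<1\}$ and the two vertices $-\zeta,\overline\zeta$. For $z\in\mathbb C$, $[z]$ is the unique $a\in\mathcal J$ with $z\in a+U$. The map $T:U\to U$ is $T(z)=\frac1z-[\frac1z]$ for $z\ne0$, $T(0)=0$ (so $T(-\zeta)=-\zeta$ and $T(\overline\zeta)=\overline\zeta$). The partial quotients $b_n(z)$ are defined as follows. If $T^m(z)\notin\{-\zeta,\overline\zeta\}$ for all $0\le m\le n-1$ and $T^{n-1}(z)\ne0$, then $b_n(z)=[1/T^{n-1}(z)]$. For the two exceptional points, for $j\ge0$, $b_{4j+1}(-\zeta)=b_{4j+2}(-\zeta)=\sqrt{-3}$, $b_{4j+3}(-\zeta)=-\overline\eta$, $b_{4j+4}(-\zeta)=\eta$, and $b_{4j+1}(\overline\zeta)=b_{4j+2}(\overline\zeta)=\sqrt{-3}$, $b_{4j+3}(\overline\zeta)=\eta$,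 $b_{4j+4}(\overline\zeta)=-\overline\eta$. If $m\ge0$ is the smallest integer with $T^m(z)=\xi\in\{-\zeta,\overline\zeta\}$, then $b_{m+k}(z)=b_k(\xi)$ for all $k\ge1$. The denominators are $q_{-1}(z)=0$, $q_0(z)=1$, $q_{n+1}(z)=b_{n+1}(z)q_n(z)+q_{n-1}(z)$, defined as long as $T^n(z)\neq0$. *)

theory Defs
  imports "HOL-Analysis.Analysis"
begin

definition sqrt_m3 :: complex where
  "sqrt_m3 = \<i> * complex_of_real (sqrt 3)"

definition zeta :: complex where
  "zeta = (1 + sqrt_m3) / 2"

definition eta :: complex where
  "eta = (3 + sqrt_m3) / 2"

definition eisenstein_ints :: "complex set" where
  "eisenstein_ints = {of_int a + of_int b * zeta | a b :: int. True}"

definition ideal_J :: "complex set" where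
  "ideal_J = (\<lambda>x. eta * x) ` eisenstein_ints"

text \<open>The open segments below are the sides of the hexagon from \<open>zeta\<close> to \<open>zeta^2\<close>, from
  \<open>zeta^4\<close> to \<open>zeta^3\<close> and from \<open>1\<close> to \<open>zeta^5\<close>, one from each pair of opposite sides.\<close>

definition fund_dom :: "complex set" where
  "fund_dom =
     interior (convex hull {zeta ^ k | k. k \<le> 5})
     \<union> open_segment zeta (- cnj zeta)
     \<union> open_segment (- zeta) (- 1)
     \<union> open_segment 1 (cnj zeta)
     \<union> {- zeta, cnj zeta}"

definition J_part :: "complex \<Rightarrow> complex" where
  "J_part z = (THE a. a \<in> ideal_J \<and> z \<in> (\<lambda>u. a + u) ` fund_dom)"

definition T :: "complex \<Rightarrow> complex" where
  "T z = (if z = 0 then 0 else 1 / z - J_part (1 / z))"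

text \<open>Partial quotients of the two exceptional points, with index \<open>k \<ge> 1\<close>; the value at
  \<open>k = 0\<close> is never used.\<close>

definition b_exc :: "complex \<Rightarrow> nat \<Rightarrow> complex" where
  "b_exc \<xi> k =
     (if k mod 4 = 1 \<or> k mod 4 = 2 then sqrt_m3
      else if k mod 4 = 3 then (if \<xi> = - zeta then - cnj eta else eta)
      else (if \<xi> = - zeta then eta else - cnj eta))"

text \<open>The partial quotient \<open>b n z\<close> is meaningful for \<open>n \<ge> 1\<close> with \<open>(T ^^ (n - 1)) z \<noteq> 0\<close>.\<close>

definition b :: "nat \<Rightarrow> complex \<Rightarrow> complex" where
  "b n z =
     (if \<exists>m<n. (T ^^ m) z \<in> {- zeta, cnj zeta}
      then let m = (LEAST m. (T ^^ m) z \<in> {- zeta, cnj zeta}) in b_exc ((T ^^ m) z) (n - m)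
      else J_part (1 / (T ^^ (n - 1)) z))"

text \<open>The index is shifted by one so that the recursion can start at the denominator of index
  \<open>-1\<close>: \<open>q_shifted k z\<close> is the denominator of index \<open>k - 1\<close>.\<close>

fun q_shifted :: "nat \<Rightarrow> complex \<Rightarrow> complex" where
  "q_shifted 0 z = 0"
| "q_shifted (Suc 0) z = 1"
| "q_shifted (Suc (Suc n)) z = b (n + 1) z * q_shifted (Suc n) z + q_shifted n z"

text \<open>As in the case of \<open>b\<close>, the value \<open>q n z\<close> is meaningful for \<open>n = 0\<close>, and for \<open>n \<ge> 1\<close> if
  \<open>(T ^^ (n - 1)) z \<noteq> 0\<close>.\<close>

definition q :: "nat \<Rightarrow> complex \<Rightarrow> complex" where
  "q n z = q_shifted (n + 1) z"

end

theory Submission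
  imports Defs
begin

text \<open>Put \<open>v\<^sub>n = q\<^sub>n\<^sub>-\<^sub>1 / q\<^sub>n\<close> and \<open>x\<^sub>n = T\<^sup>n z\<close>, so that \<open>v\<^sub>n\<^sub>+\<^sub>1 = 1 / (b + v\<^sub>n)\<close>
  and \<open>x\<^sub>n\<^sub>+\<^sub>1 = 1 / x\<^sub>n - b\<close> with \<open>b = b\<^sub>n\<^sub>+\<^sub>1\<close>; the claim is that \<open>v\<^sub>n\<close> stays in the open unit disc. This can fail only for \<open>|b| = \<surd>3\<close>
  and \<open>|v\<^sub>n + b| \<le> 1\<close>. For each \<open>a\<close> of norm \<open>\<surd>3\<close> in the lattice consider the discs \<open>|v + a| \<le> 1\<close> and
  \<open>|v + a/2| \<le> 1/2\<close>. If \<open>v\<^sub>n\<close> lies in one of them, then the preceding partial quotients are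
  restricted, and this keeps \<open>x\<^sub>n\<close> outside the open disc of radius \<open>1/\<surd>3\<close> about \<open>cnj a / 3\<close>,
  respectively about \<open>2 cnj a / 3\<close>. These two implications are preserved by each step, and with
  \<open>|v\<^sub>n + b| \<le> 1\<close> they force \<open>|x\<^sub>n| = 1\<close>, that is, \<open>x\<^sub>n\<close> is one of the two exceptional
  vertices. From the first visit to such a vertex on, the forbidden position of \<open>v\<^sub>n\<close> would
  prescribe up to three preceding partial quotients; these never agree with the periodic
  pattern, or else force \<open>|x\<^sub>j| \<ge> 1\<close> at the step before the first visit.\<close>

section \<open>The lattice and its hexagonal fundamental domain\<close>

text \<open>In these coordinates the closed hexagon is \<open>|s|, |t|, |s + t| \<le> 1\<close>, the lattice \<open>J\<close>
  consists of the integer points with \<open>s \<equiv> t\<close> modulo 3, and complex conjugation is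
  \<open>(s, t) \<mapsto> (-t, -s)\<close>.\<close>

definition coord1 :: "complex \<Rightarrow> real" where
  "coord1 z = Re z + Im z / sqrt 3"

definition coord2 :: "complex \<Rightarrow> real" where
  "coord2 z = Im z / sqrt 3 - Re z"

lemma Re_coord: "Re z = (coord1 z - coord2 z) / 2"
  by (simp add: coord1_def coord2_def)

lemma Im_coord: "Im z = sqrt 3 * (coord1 z + coord2 z) / 2"
  by (simp add: coord1_def coord2_def)

lemma coord_eqI: "coord1 z = coord1 w \<Longrightarrow> coord2 z = coord2 w \<Longrightarrow> z = w"
  by (simp add: complex_eq_iff Re_coord Im_coord)

lemma complex_eq_coord: "z = w \<longleftrightarrow> coord1 z = coord1 w \<and> coord2 z = coord2 w"
  by (auto intro: coord_eqI)

lemma coord_linear [simp]: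
  "coord1 (z + w) = coord1 z + coord1 w" "coord2 (z + w) = coord2 z + coord2 w"
  "coord1 (z - w) = coord1 z - coord1 w" "coord2 (z - w) = coord2 z - coord2 w"
  "coord1 (- z) = - coord1 z" "coord2 (- z) = - coord2 z"
  "coord1 0 = 0" "coord2 0 = 0"
  "coord1 (r *\<^sub>R z) = r * coord1 z" "coord2 (r *\<^sub>R z) = r * coord2 z"
  "coord1 (of_real r * z) = r * coord1 z" "coord2 (of_real r * z) = r * coord2 z"
  by (auto simp: coord1_def coord2_def field_simps)

lemma coord_of_int_mult [simp]:
  "coord1 (of_int k * z) = of_int k * coord1 z" "coord2 (of_int k * z) = of_int k * coord2 z"
  using coord_linear(11)[of "of_int k" z] coord_linear(12)[of "of_int k" z] by simp_all

text \<open>The coordinates refer to the basis \<open>zeta\<close>, \<open>zeta ^ 2\<close> of unit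
  vectors with inner product 1/2.\<close>

lemma inner_coord:
  "inner a z = coord1 a * coord1 z + coord2 a * coord2 z
     + (coord1 a * coord2 z + coord2 a * coord1 z) / 2"
proof -
  have "sqrt 3 * (sqrt 3 * r) = 3 * r" for r :: real
    by (simp flip: mult.assoc)
  then show ?thesis
    by (simp add: inner_complex_def Re_coord Im_coord algebra_simps)
      (simp add: field_simps)
qed

lemma norm_coord: "(norm z)\<^sup>2 = (coord1 z)\<^sup>2 + coord1 z * coord2 z + (coord2 z)\<^sup>2"
  unfolding power2_norm_eq_inner inner_coord by (simp add: power2_eq_square)

lemma coord_consts [simp]:
  "coord1 sqrt_m3 = 1" "coord2 sqrt_m3 = 1"
  "coord1 eta = 2" "coord2 eta = -1"
  "coord1 zeta = 1" "coord2 zeta = 0"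
  "coord1 1 = 1" "coord2 1 = -1"
  by (auto simp: coord1_def coord2_def sqrt_m3_def eta_def zeta_def)

lemma coord_cnj [simp]: "coord1 (cnj z) = - coord2 z" "coord2 (cnj z) = - coord1 z"
  by (auto simp: coord1_def coord2_def)

lemma eta_mult_zeta: "eta * zeta = sqrt_m3"
  by (simp add: eta_def zeta_def sqrt_m3_def complex_eq_iff field_simps)

lemma zeta_powers: "zeta ^ 2 = - cnj zeta" "zeta ^ 3 = -1"
proof -
  show "zeta ^ 2 = - cnj zeta"
    by (simp add: zeta_def sqrt_m3_def complex_eq_iff field_simps power2_eq_square)
  then have "zeta ^ 3 = - (zeta * cnj zeta)"
    by (simp add: power3_eq_cube power2_eq_square)
  then show "zeta ^ 3 = -1"
    by (simp add: zeta_def sqrt_m3_def complex_eq_iff field_simps)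
qed

text \<open>\<open>m\<close> and \<open>n\<close> are the coefficients in the lattice basis
  \<open>eta\<close>, \<open>eta * zeta = sqrt_m3\<close>.\<close>

lemma ideal_J_iff:
  "a \<in> ideal_J \<longleftrightarrow> (\<exists>(m::int) (n::int). coord1 a = 2 * m + n \<and> coord2 a = n - m)"
proof
  assume "a \<in> ideal_J"
  then obtain m n :: int where "a = eta * (of_int m + of_int n * zeta)"
    by (auto simp: ideal_J_def eisenstein_ints_def)
  then have "a = of_int m * eta + of_int n * sqrt_m3"
    by (simp add: algebra_simps flip: eta_mult_zeta)
  then have "coord1 a = 2 * m + n \<and> coord2 a = n - m" by simp
  then show "\<exists>(m::int) (n::int). coord1 a = 2 * m + n \<and> coord2 a = n - m" by force
next
  assume "\<exists>(m::int) (n::int). coord1 a = 2 * m + n \<and> coord2 a = n - m"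
  then obtain m n :: int where "coord1 a = 2 * m + n" "coord2 a = n - m" by force
  then have "a = of_int m * eta + of_int n * sqrt_m3"
    by (intro coord_eqI) simp_all
  then have "a = eta * (of_int m + of_int n * zeta)"
    by (simp add: algebra_simps flip: eta_mult_zeta)
  then show "a \<in> ideal_J"
    by (auto simp: ideal_J_def eisenstein_ints_def)
qed

lemma ideal_J_diff: assumes "a \<in> ideal_J" "c \<in> ideal_J" shows "a - c \<in> ideal_J"
proof -
  obtain m n m' n' :: int where "coord1 a = 2 * m + n" "coord2 a = n - m"
    "coord1 c = 2 * m' + n'" "coord2 c = n' - m'"
    using assms by (auto simp: ideal_J_iff)
  then show ?thesis unfolding ideal_J_iff
    by (intro exI[of _ "m - m'"] exI[of _ "n - n'"]) simp
qed

lemma ideal_J_0: "0 \<in> ideal_J"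
  unfolding ideal_J_iff by (intro exI[of _ 0]) simp

lemma ideal_J_minus: "a \<in> ideal_J \<Longrightarrow> - a \<in> ideal_J"
  using ideal_J_diff[OF ideal_J_0] by simp

lemma ideal_J_add: "a \<in> ideal_J \<Longrightarrow> c \<in> ideal_J \<Longrightarrow> a + c \<in> ideal_J"
  using ideal_J_diff[OF _ ideal_J_minus] by force

lemma ideal_J_cnj: assumes "a \<in> ideal_J" shows "cnj a \<in> ideal_J"
proof -
  obtain m n :: int where "coord1 a = 2 * m + n" "coord2 a = n - m"
    using assms by (auto simp: ideal_J_iff)
  \<comment> \<open>The witnesses come from \<open>cnj eta = eta - sqrt_m3\<close> and
    \<open>cnj sqrt_m3 = - sqrt_m3\<close>.\<close>
  then show ?thesis unfolding ideal_J_iff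
    by (intro exI[of _ "m"] exI[of _ "- m - n"]) simp
qed

text \<open>The squared norm is 3 times the integer \<open>m\<^sup>2 + m * n + n\<^sup>2\<close>.
  The bound 4 is what makes lattice vectors of norm below 2 minimal.\<close>

lemma ideal_J_norm:
  assumes "a \<in> ideal_J" "a \<noteq> 0"
  shows "(norm a)\<^sup>2 = 3 \<or> 4 \<le> (norm a)\<^sup>2"
proof -
  obtain m n :: int where mn: "coord1 a = 2 * m + n" "coord2 a = n - m"
    using assms by (auto simp: ideal_J_iff)
  have eq: "(norm a)\<^sup>2 = of_int (3 * (m\<^sup>2 + m * n + n\<^sup>2))"
    unfolding norm_coord mn by (simp add: power2_eq_square algebra_simps)
  moreover have "0 < (norm a)\<^sup>2" using assms by simp
  ultimately have "0 < 3 * (m\<^sup>2 + m * n + n\<^sup>2)" by linarith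
  moreover have "k = 1 \<or> 2 \<le> k" if "0 < 3 * k" for k :: int using that by arith
  ultimately have "m\<^sup>2 + m * n + n\<^sup>2 = 1 \<or> 2 \<le> m\<^sup>2 + m * n + n\<^sup>2" by blast
  then show ?thesis
  proof
    assume "m\<^sup>2 + m * n + n\<^sup>2 = 1" then show ?thesis using eq by simp
  next
    assume "2 \<le> m\<^sup>2 + m * n + n\<^sup>2"
    then have "4 \<le> 3 * (m\<^sup>2 + m * n + n\<^sup>2)" by simp
    then have "real_of_int 4 \<le> (norm a)\<^sup>2" unfolding eq of_int_le_iff .
    then show ?thesis by simp
  qed
qed

lemma ideal_J_norm_ge: "a \<in> ideal_J \<Longrightarrow> a \<noteq> 0 \<Longrightarrow> 3 \<le> (norm a)\<^sup>2"
  using ideal_J_norm by force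

section \<open>The six shortest lattice vectors\<close>

definition min_J :: "complex set" where
  "min_J = {a \<in> ideal_J. (norm a)\<^sup>2 = 3}"

lemma min_J_coord:
  assumes "a \<in> min_J"
  shows "(coord1 a, coord2 a) \<in> {(1, 1), (-1, -1), (2, -1), (-2, 1), (1, -2), (-1, 2)}"
proof -
  obtain m n :: int where mn: "coord1 a = 2 * m + n" "coord2 a = n - m"
    using assms by (auto simp: ideal_J_iff min_J_def)
  have "(norm a)\<^sup>2 = of_int (3 * (m\<^sup>2 + m * n + n\<^sup>2))"
    unfolding norm_coord mn by (simp add: power2_eq_square algebra_simps)
  then have "real_of_int (3 * (m\<^sup>2 + m * n + n\<^sup>2)) = of_int 3" using assms by (simp add: min_J_def)
  then have e: "m\<^sup>2 + m * n + n\<^sup>2 = 1" unfolding of_int_eq_iff by simp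
  \<comment> \<open>Completing the square in one variable bounds the other, so only nine pairs
    \<open>m\<close>, \<open>n\<close> remain.\<close>
  have *: "4 * (m\<^sup>2 + m * n + n\<^sup>2) = (2 * m + n)\<^sup>2 + 3 * n\<^sup>2"
    "4 * (m\<^sup>2 + m * n + n\<^sup>2) = (2 * n + m)\<^sup>2 + 3 * m\<^sup>2"
    by (simp_all add: power2_eq_square algebra_simps)
  have "n\<^sup>2 < 2\<^sup>2" "m\<^sup>2 < 2\<^sup>2"
  proof -
    have "t < 2\<^sup>2" if "4 = s + 3 * t" "0 \<le> s" for s t :: int using that by simp
    with * show "n\<^sup>2 < 2\<^sup>2" "m\<^sup>2 < 2\<^sup>2" unfolding e by (metis mult_1_right zero_le_power2)+
  qed
  then have "\<bar>m\<bar> < 2" "\<bar>n\<bar> < 2"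
    using power2_less_imp_less[of "\<bar>m\<bar>" 2] power2_less_imp_less[of "\<bar>n\<bar>" 2] by auto
  then have "m \<in> {-1, 0, 1}" "n \<in> {-1, 0, 1}" by auto
  then show ?thesis using e mn by auto
qed

section \<open>The hexagon and the tiling by its translates\<close>

lemma convex_hull_hexagon:
  "convex hull {zeta ^ k | k. k \<le> 5}
     = {z. \<bar>coord1 z\<bar> \<le> 1 \<and> \<bar>coord2 z\<bar> \<le> 1 \<and> \<bar>coord1 z + coord2 z\<bar> \<le> 1}"
    (is "convex hull ?S = ?H")
proof
  have p: "zeta ^ 4 = - zeta" "zeta ^ 5 = cnj zeta"
    using zeta_powers by (simp_all add: numeral_eq_Suc)
  have k: "{k::nat. k \<le> 5} = {0, 1, 2, 3, 4, 5}" by auto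
  have "?S = (\<lambda>k. zeta ^ k) ` {k. k \<le> 5}" by auto
  then have S: "?S = {1, zeta, - cnj zeta, -1, - zeta, cnj zeta}"
    unfolding k using p zeta_powers by simp
  have "convex ?H"
  proof (rule convexI)
    fix x y u v assume *: "x \<in> ?H" "y \<in> ?H" "0 \<le> (u::real)" "0 \<le> v" "u + v = 1"
    have "\<bar>u * s + v * t\<bar> \<le> 1" if "\<bar>s\<bar> \<le> 1" "\<bar>t\<bar> \<le> 1" for s t :: real
    proof -
      have "\<bar>u * s + v * t\<bar> \<le> u * \<bar>s\<bar> + v * \<bar>t\<bar>"
        using * abs_triangle_ineq[of "u * s" "v * t"] by (simp add: abs_mult)
      also have "\<dots> \<le> u * 1 + v * 1" using that * by (intro add_mono mult_left_mono) auto
      finally show ?thesis using * by simp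
    qed
    from this[of "coord1 x" "coord1 y"] this[of "coord2 x" "coord2 y"]
      this[of "coord1 x + coord2 x" "coord1 y + coord2 y"] *
    show "u *\<^sub>R x + v *\<^sub>R y \<in> ?H" by (simp add: algebra_simps)
  qed
  then show "convex hull ?S \<subseteq> ?H"
    unfolding S by (intro hull_minimal) auto
  let ?C = "convex hull ?S"
  have vert: "1 \<in> ?C" "zeta \<in> ?C" "- cnj zeta \<in> ?C" "-1 \<in> ?C" "- zeta \<in> ?C" "cnj zeta \<in> ?C"
    unfolding S by (auto intro!: hull_inc)
  have "(1/2) *\<^sub>R 1 + (1/2) *\<^sub>R (-1) \<in> ?C"
    by (rule convexD[OF convex_convex_hull]) (use vert in auto)
  then have z0: "0 \<in> ?C" by simp
  \<comment> \<open>Membership in the triangle 0, \<open>x\<close>, \<open>y\<close>. Below, the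
    hexagon is cut into six such triangles over adjacent vertices, according to the signs of
    \<open>coord1 z\<close>, \<open>coord2 z\<close> and their sum.\<close>
  have tri: "z \<in> ?C" if "x \<in> ?C" "y \<in> ?C" "0 \<le> s" "0 \<le> t" "s + t \<le> 1"
    "coord1 z = s * coord1 x + t * coord1 y" "coord2 z = s * coord2 x + t * coord2 y" for x y z s t
  proof -
    have "s *\<^sub>R x + t *\<^sub>R y \<in> ?C"
    proof (cases "s + t = 0")
      case True then have "s = 0" "t = 0" using that(3,4) by simp_all
      then show ?thesis using z0 by simp
    next
      case False
      have "(s / (s + t)) *\<^sub>R x + (t / (s + t)) *\<^sub>R y \<in> ?C"
        using that False by (intro convexD[OF convex_convex_hull]) (auto simp flip: add_divide_distrib)
      from convexD[OF convex_convex_hull this z0, of "s + t" "1 - (s + t)"]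
      show ?thesis using that False by (simp add: scaleR_add_right)
    qed
    moreover have "z = s *\<^sub>R x + t *\<^sub>R y" by (intro coord_eqI) (use that in simp_all)
    ultimately show ?thesis by simp
  qed
  show "?H \<subseteq> ?C"
  proof
    fix z assume z: "z \<in> ?H"
    let ?p = "coord1 z" and ?q = "coord2 z"
    consider "0 \<le> ?p" "0 \<le> ?q" | "?p \<le> 0" "?q \<le> 0" | "?q \<le> 0" "0 \<le> ?p + ?q"
      | "0 \<le> ?p" "?p + ?q \<le> 0" | "?p \<le> 0" "0 \<le> ?p + ?q" | "0 \<le> ?q" "?p + ?q \<le> 0"
      by linarith
    then show "z \<in> ?C"
    proof cases
      case 1 then show ?thesis using z by (intro tri[OF vert(2) vert(3), of ?p ?q]) auto
    next
      case 2 then show ?thesis using z by (intro tri[OF vert(5) vert(6), of "-?p" "-?q"]) auto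
    next
      case 3 then show ?thesis using z by (intro tri[OF vert(1) vert(2), of "-?q" "?p + ?q"]) auto
    next
      case 4 then show ?thesis using z by (intro tri[OF vert(1) vert(6), of "?p" "-?p-?q"]) auto
    next
      case 5 then show ?thesis using z by (intro tri[OF vert(4) vert(3), of "-?p" "?p + ?q"]) auto
    next
      case 6 then show ?thesis using z by (intro tri[OF vert(4) vert(5), of "?q" "-?p-?q"]) auto
    qed
  qed
qed

lemma interior_hexagon:
  "interior (convex hull {zeta ^ k | k. k \<le> 5})
     = {z. \<bar>coord1 z\<bar> < 1 \<and> \<bar>coord2 z\<bar> < 1 \<and> \<bar>coord1 z + coord2 z\<bar> < 1}"
proof -
  have i: "interior {z. \<bar>inner a z\<bar> \<le> 1} = {z. \<bar>inner a z\<bar> < 1}" if "a \<noteq> 0" for a :: complex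
  proof -
    have "{z. \<bar>inner a z\<bar> \<le> 1} = {z. inner a z \<le> 1} \<inter> {z. inner a z \<ge> -1}" by auto
    then show ?thesis using that by (auto simp: interior_halfspace_le interior_halfspace_ge)
  qed
  let ?a = "Complex 1 (1 / sqrt 3)" and ?b = "Complex (-1) (1 / sqrt 3)"
  have c: "coord1 z = inner ?a z" "coord2 z = inner ?b z"
    "coord1 z + coord2 z = inner (?a + ?b) z" for z
    by (simp_all add: coord1_def coord2_def inner_complex_def)
  have n: "?a \<noteq> 0" "?b \<noteq> 0" "?a + ?b \<noteq> 0" by (simp_all add: complex_eq_iff)
  show ?thesis
    unfolding convex_hull_hexagon c(3) unfolding c(1,2) Collect_conj_eq interior_Int
      i[OF n(1)] i[OF n(2)] i[OF n(3)] ..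
qed

text \<open>The three sides of \<open>U\<close> lie on \<open>coord1 z + coord2 z = 1\<close>,
  \<open>coord1 z = -1\<close> and \<open>coord2 z = -1\<close>, whence the non-strict inequalities.
  The two vertices lie on the excluded line \<open>coord1 z + coord2 z = -1\<close>.\<close>

lemma fund_dom_iff:
  "z \<in> fund_dom \<longleftrightarrow>
     -1 \<le> coord1 z \<and> coord1 z < 1 \<and> -1 \<le> coord2 z \<and> coord2 z < 1
       \<and> -1 < coord1 z + coord2 z \<and> coord1 z + coord2 z \<le> 1
     \<or> z \<in> {- zeta, cnj zeta}"
proof -
  have seg: "z \<in> open_segment x y \<longleftrightarrow> (\<exists>u. 0 < u \<and> u < 1
      \<and> coord1 z = (1 - u) * coord1 x + u * coord1 y
      \<and> coord2 z = (1 - u) * coord2 x + u * coord2 y)" if "x \<noteq> y" for x y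
  proof -
    have "z = (1 - u) *\<^sub>R x + u *\<^sub>R y \<longleftrightarrow> coord1 z = (1 - u) * coord1 x + u * coord1 y
        \<and> coord2 z = (1 - u) * coord2 x + u * coord2 y" for u
      by (auto intro: coord_eqI)
    then show ?thesis unfolding in_segment(2) using that by simp
  qed
  have ne: "zeta \<noteq> - cnj zeta" "- zeta \<noteq> - 1" "1 \<noteq> cnj zeta"
    by (simp_all add: zeta_def sqrt_m3_def complex_eq_iff)
  have s1: "z \<in> open_segment zeta (- cnj zeta) \<longleftrightarrow> coord1 z + coord2 z = 1 \<and> 0 < coord2 z \<and> coord2 z < 1"
    unfolding seg[OF ne(1)] by (auto intro: exI[of _ "coord2 z"])
  have s2: "z \<in> open_segment (- zeta) (- 1) \<longleftrightarrow> coord1 z = -1 \<and> 0 < coord2 z \<and> coord2 z < 1"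
    unfolding seg[OF ne(2)] by (auto intro: exI[of _ "coord2 z"])
  have s3: "z \<in> open_segment 1 (cnj zeta) \<longleftrightarrow> coord2 z = -1 \<and> 0 < coord1 z \<and> coord1 z < 1"
    unfolding seg[OF ne(3)] by (auto intro: exI[of _ "1 - coord1 z"])
  show ?thesis
    unfolding fund_dom_def interior_hexagon Un_iff s1 s2 s3 mem_Collect_eq by auto
qed

lemma fund_dom_coord:
  assumes "z \<in> fund_dom"
  shows "-1 \<le> coord1 z \<and> coord1 z < 1 \<and> -1 \<le> coord2 z \<and> coord2 z < 1
    \<and> -1 \<le> coord1 z + coord2 z \<and> coord1 z + coord2 z \<le> 1"
  using assms unfolding fund_dom_iff by auto

lemma fund_dom_tiling: "\<exists>!a. a \<in> ideal_J \<and> z - a \<in> fund_dom"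
proof (rule ex_ex1I)
  let ?i = "\<lfloor>coord1 z\<rfloor>" and ?j = "\<lfloor>coord2 z\<rfloor>"
  define p where "p = frac (coord1 z)"
  define r where "r = frac (coord2 z)"
  have pr: "0 \<le> p" "p < 1" "0 \<le> r" "r < 1" by (auto simp: p_def r_def frac_lt_1)
  have c: "coord1 z = ?i + p" "coord2 z = ?j + r" by (auto simp: p_def r_def frac_def)
  \<comment> \<open>Translations by the lattice reach every pair of integer parts whose difference
    has the same residue modulo 3.\<close>
  have ex: "\<exists>a. a \<in> ideal_J \<and> coord1 (z - a) = e + p \<and> coord2 (z - a) = f + r"
    if "(?i - ?j) mod 3 = (e - f) mod 3" for e f :: int
  proof -
    have "3 dvd (?i - ?j) - (e - f)" using that by (rule mod_eq_dvd_iff[THEN iffD1])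
    then obtain m where m: "(?i - ?j) - (e - f) = 3 * m" by (auto elim: dvdE)
    define n where "n = ?j - f + m"
    define a where "a = of_int m * eta + of_int n * sqrt_m3"
    have i: "real_of_int ?i - e = 2 * m + n" "real_of_int ?j - f = n - m"
      using m unfolding n_def of_int_eq_iff[where 'a=real, symmetric] by simp_all
    have "a \<in> ideal_J" unfolding ideal_J_iff by (intro exI[of _ m] exI[of _ n]) (simp add: a_def)
    moreover have "coord1 (z - a) = e + p \<and> coord2 (z - a) = f + r"
      using i c unfolding a_def by simp
    ultimately show ?thesis by blast
  qed
  \<comment> \<open>For residue 0 the unit cell is split along \<open>p + r = 1\<close> and its
    upper triangle shifted by (-1, -1). For residues 1 and 2 the cells at (0, -1) and (-1, 0) lie in
    \<open>U\<close>, their corners being the two vertices of \<open>U\<close>.\<close>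
  consider "(?i - ?j) mod 3 = 0" | "(?i - ?j) mod 3 = 1" | "(?i - ?j) mod 3 = 2" by linarith
  then show "\<exists>a. a \<in> ideal_J \<and> z - a \<in> fund_dom"
  proof cases
    case 1
    show ?thesis
    proof (cases "p + r \<le> 1")
      case True
      obtain a where "a \<in> ideal_J" "coord1 (z - a) = p" "coord2 (z - a) = r"
        using ex[of 0 0] 1 by auto
      then show ?thesis using pr True unfolding fund_dom_iff by (intro exI[of _ a]) auto
    next
      case False
      obtain a where "a \<in> ideal_J" "coord1 (z - a) = p - 1" "coord2 (z - a) = r - 1"
        using ex[of "-1" "-1"] 1 by auto
      then show ?thesis using pr False unfolding fund_dom_iff by (intro exI[of _ a]) auto
    qed
  next
    case 2
    obtain a where a: "a \<in> ideal_J" "coord1 (z - a) = p" "coord2 (z - a) = r - 1"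
      using ex[of 0 "-1"] 2 by auto
    have "z - a = cnj zeta" if "p = 0" "r = 0" using that a by (intro coord_eqI) simp_all
    moreover have "-1 < p + (r - 1)" if "\<not> (p = 0 \<and> r = 0)" using that pr by auto
    ultimately show ?thesis using a pr unfolding fund_dom_iff
      by (intro exI[of _ a]) (cases "p = 0 \<and> r = 0"; auto)
  next
    case 3
    obtain a where a: "a \<in> ideal_J" "coord1 (z - a) = p - 1" "coord2 (z - a) = r"
      using ex[of "-1" 0] 3 by auto
    have "z - a = - zeta" if "p = 0" "r = 0" using that a by (intro coord_eqI) simp_all
    moreover have "-1 < (p - 1) + r" if "\<not> (p = 0 \<and> r = 0)" using that pr by auto
    ultimately show ?thesis using a pr unfolding fund_dom_iff
      by (intro exI[of _ a]) (cases "p = 0 \<and> r = 0"; auto)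
  qed
next
  fix a a' assume *: "a \<in> ideal_J \<and> z - a \<in> fund_dom" "a' \<in> ideal_J \<and> z - a' \<in> fund_dom"
  have key: "coord1 a' \<ge> coord1 a \<and> coord2 a' \<ge> coord2 a"
    if *: "a \<in> ideal_J" "z - a \<in> fund_dom" "a' \<in> ideal_J" "z - a' \<in> fund_dom" for a a'
  proof -
    obtain m n :: int where mn: "coord1 (a' - a) = 2 * m + n" "coord2 (a' - a) = n - m"
      using ideal_J_diff[OF *(3) *(1)] by (auto simp: ideal_J_iff)
    note d = fund_dom_coord[OF *(2)] fund_dom_coord[OF *(4)]
    have "real_of_int (2 * m + n) < of_int 2" "of_int (-2) < real_of_int (2 * m + n)"
      "real_of_int (n - m) < of_int 2" "of_int (-2) < real_of_int (n - m)"
      using mn d by auto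
    then have "2 * m + n < 2" "-2 < 2 * m + n" "n - m < 2" "-2 < n - m"
      unfolding of_int_less_iff by auto
    then have mn0: "m = 0" "\<bar>n\<bar> \<le> 1" by presburger+
    \<comment> \<open>For \<open>n = -1\<close> the coordinate sum would rise by 2, hence from -1 to
      1. In \<open>U\<close> the sum -1 occurs only at the two vertices, which would be moved to a
      point with a coordinate 1.\<close>
    have "n \<noteq> -1"
    proof
      assume "n = -1"
      then have c: "coord1 (z - a') = coord1 (z - a) + 1" "coord2 (z - a') = coord2 (z - a) + 1"
        using mn mn0 by simp_all
      then have "coord1 (z - a) + coord2 (z - a) = -1" using d by auto
      then have "z - a \<in> {- zeta, cnj zeta}" using *(2) unfolding fund_dom_iff by auto
      then have "coord1 (z - a') = 1 \<or> coord2 (z - a') = 1"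
        unfolding c by (auto simp del: coord_linear(3,4))
      then show False using d by auto
    qed
    then show ?thesis using mn0 mn by auto
  qed
  have "coord1 a' \<ge> coord1 a \<and> coord2 a' \<ge> coord2 a" "coord1 a \<ge> coord1 a' \<and> coord2 a \<ge> coord2 a'"
    using key[of a a'] key[of a' a] * by blast+
  then show "a = a'" by (intro coord_eqI) simp_all
qed

lemma J_part_props: "J_part z \<in> ideal_J" "z - J_part z \<in> fund_dom"
proof -
  have "z \<in> (\<lambda>u. a + u) ` fund_dom \<longleftrightarrow> z - a \<in> fund_dom" for a
    by (auto simp: image_iff intro: bexI[of _ "z - a"])
  then have "J_part z = (THE a. a \<in> ideal_J \<and> z - a \<in> fund_dom)"
    by (simp add: J_part_def)
  then show "J_part z \<in> ideal_J" "z - J_part z \<in> fund_dom"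
    using theI'[OF fund_dom_tiling[of z]] by simp_all
qed

text \<open>The closed hexagon is the Voronoi cell of 0, and \<open>inner a z = - (3 / 2)\<close> is
  the bisector of 0 and \<open>- a\<close>.\<close>

lemma fund_dom_inner:
  assumes "z \<in> fund_dom" "a \<in> min_J"
  shows "- (3 / 2) \<le> inner a z"
  using fund_dom_coord[OF assms(1)] min_J_coord[OF assms(2)]
  by (auto simp: inner_coord field_simps)

text \<open>The hexagon is inscribed in the unit circle. If \<open>p\<close>, \<open>r\<close> have
  equal signs, the form is compared with \<open>(p + r)\<^sup>2\<close>; otherwise it is written as
  \<open>p\<^sup>2 + r * (p + r)\<close> or \<open>r\<^sup>2 + p * (p + r)\<close>.\<close>

lemma fund_dom_norm:
  assumes "z \<in> fund_dom" "z \<notin> {- zeta, cnj zeta}"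
  shows "norm z < 1"
proof -
  define p where "p = coord1 z"
  define r where "r = coord2 z"
  have c: "-1 \<le> p" "p < 1" "-1 \<le> r" "r < 1" "-1 < p + r" "p + r \<le> 1"
    using assms unfolding fund_dom_iff p_def r_def by auto
  have sq: "t\<^sup>2 < 1" if "-1 < t" "t < 1" for t :: real
    using that by (simp add: abs_square_less_1)
  consider "0 < p" "0 < r" | "p = 0 \<or> r = 0" | "p < 0" "r < 0"
    | "0 < p" "r < 0" | "p < 0" "0 < r"
    by linarith
  then have "p\<^sup>2 + p * r + r\<^sup>2 < 1"
  proof cases
    case 1
    have "0 < p * r" using 1 by simp
    moreover have "(p + r)\<^sup>2 \<le> 1" using 1 c by (simp add: abs_square_le_1)
    ultimately show ?thesis by (simp add: power2_sum)
  next
    case 2 then show ?thesis using c sq[of p] sq[of r] by auto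
  next
    case 3
    have "0 < p * r" using 3 by (simp add: mult_neg_neg)
    moreover have "(p + r)\<^sup>2 < 1" using 3 c by (intro sq) auto
    ultimately show ?thesis by (simp add: power2_sum)
  next
    case 4
    show ?thesis
    proof (cases "0 \<le> p + r")
      case True
      have "r * (p + r) \<le> 0" using 4 True by (simp add: mult_nonpos_nonneg)
      then show ?thesis using sq[of p] 4 c by (simp add: power2_eq_square algebra_simps)
    next
      case False
      have "p * (p + r) < 0" using 4 False by (simp add: mult_pos_neg)
      moreover have "r\<^sup>2 \<le> 1" using 4 c by (simp add: abs_square_le_1)
      ultimately show ?thesis by (simp add: power2_eq_square algebra_simps)
    qed
  next
    case 5
    show ?thesis
    proof (cases "0 \<ge> p + r")
      case True
      have "r * (p + r) \<le> 0" using 5 True by (simp add: mult_nonneg_nonpos)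
      moreover have "p\<^sup>2 \<le> 1" using 5 c by (simp add: abs_square_le_1)
      \<comment> \<open>The side \<open>p = -1\<close> belongs to \<open>U\<close>; there
        \<open>r < 1\<close> makes the product strictly negative.\<close>
      moreover have "r * (p + r) < 0 \<or> p\<^sup>2 < 1"
        using 5 True c sq[of p] by (cases "p = -1") (auto simp: mult_pos_neg)
      ultimately show ?thesis by (auto simp: power2_eq_square algebra_simps)
    next
      case False
      have "p * (p + r) < 0" using 5 False by (simp add: mult_neg_pos)
      then show ?thesis using sq[of r] 5 c by (simp add: power2_eq_square algebra_simps)
    qed
  qed
  then have "(norm z)\<^sup>2 < 1\<^sup>2" unfolding norm_coord p_def r_def by simp
  then show ?thesis by (rule power2_less_imp_less) simp
qed

lemma norm_exceptional: "\<xi> \<in> {- zeta, cnj zeta} \<Longrightarrow> norm \<xi> = 1"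
proof -
  have "(norm zeta)\<^sup>2 = 1" unfolding norm_coord by simp
  then have "norm zeta = 1" using power2_eq_1_iff[of "norm zeta"] norm_ge_zero[of zeta] by linarith
  then show "\<xi> \<in> {- zeta, cnj zeta} \<Longrightarrow> norm \<xi> = 1" by auto
qed

section \<open>One step of the continued fraction\<close>

text \<open>For \<open>a\<close> as the next partial quotient, these are the positions of
  \<open>v\<close> in which the denominators would fail to grow.\<close>

definition unit_disc :: "complex \<Rightarrow> complex set" where
  "unit_disc a = {v. norm (v + a) \<le> 1}"

text \<open>For \<open>a\<close> in \<open>min_J\<close>, the image of
  \<open>unit_disc (cnj a)\<close> under inversion.\<close>

definition small_disc :: "complex \<Rightarrow> complex set" where
  "small_disc a = {v. norm (v + a / 2) \<le> 1 / 2}"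

text \<open>The two inequalities say that \<open>x\<close> has distance at least \<open>1/\<surd>3\<close> from \<open>cnj a / 3\<close> and from
  \<open>2 cnj a / 3\<close>. Inversion turns the first circle into the line \<open>inner a (1/x) = 3/2\<close>, which carries
  the side of \<open>a + U\<close> facing the origin.\<close>

definition compatible :: "complex \<Rightarrow> complex \<Rightarrow> bool" where
  "compatible x v \<longleftrightarrow>
     (\<forall>a\<in>min_J. v \<in> unit_disc a \<longrightarrow> 2 * inner (cnj a) x \<le> 3 * (norm x)\<^sup>2)
     \<and> (\<forall>a\<in>min_J. v \<in> small_disc a \<longrightarrow> 4 * inner (cnj a) x \<le> 3 * (norm x)\<^sup>2 + 3)"

lemma min_J_cnj: "a \<in> min_J \<Longrightarrow> - cnj a \<in> min_J"
  by (simp add: min_J_def ideal_J_minus ideal_J_cnj)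

lemma norm_add_sq: "(norm (x + y))\<^sup>2 = (norm x)\<^sup>2 + 2 * inner x y + (norm y)\<^sup>2"
  for x y :: complex
  by (simp add: power2_norm_eq_inner inner_add_left inner_add_right inner_commute)

lemma norm_diff_sq: "(norm (x - y))\<^sup>2 = (norm x)\<^sup>2 - 2 * inner x y + (norm y)\<^sup>2"
  for x y :: complex
  by (simp add: power2_norm_eq_inner inner_diff_left inner_diff_right inner_commute)

lemma inner_half: "inner x (y / 2) = inner x y / 2" "inner (y / 2) x = inner y x / 2" for x y :: complex
  by (simp_all add: inner_complex_def add_divide_distrib)

lemma norm_le_sq_iff: "norm x \<le> r \<longleftrightarrow> (norm x)\<^sup>2 \<le> r\<^sup>2" if "0 \<le> r"
  using that by (metis abs_le_square_iff abs_norm_cancel abs_of_nonneg)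

lemma unit_disc_iff: "a \<in> min_J \<Longrightarrow> v \<in> unit_disc a \<longleftrightarrow> (norm v)\<^sup>2 + 2 * inner a v + 2 \<le> 0"
  by (auto simp: unit_disc_def min_J_def norm_le_sq_iff norm_add_sq inner_commute)

lemma small_disc_iff: "a \<in> min_J \<Longrightarrow> v \<in> small_disc a \<longleftrightarrow> 2 * (norm v)\<^sup>2 + 2 * inner a v + 1 \<le> 0"
proof -
  assume a: "a \<in> min_J"
  have "v \<in> small_disc a \<longleftrightarrow> (norm (v + a / 2))\<^sup>2 \<le> (1 / 2)\<^sup>2"
    unfolding small_disc_def mem_Collect_eq by (rule norm_le_sq_iff) simp
  then show ?thesis using a
    by (auto simp: min_J_def norm_add_sq inner_commute inner_half norm_divide power_divide)
qed

section \<open>The discs under inversion and the partial quotients leading into them\<close>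

lemma norm_inverse_sq: "w \<noteq> 0 \<Longrightarrow> (norm (1 / w))\<^sup>2 * (norm w)\<^sup>2 = 1" for w :: complex
  by (simp add: norm_divide power_divide)

text \<open>\<open>1 / w\<close> is a positive multiple of \<open>cnj w\<close>. This form serves to
  multiply inequalities about \<open>1 / w\<close> by \<open>(norm w)\<^sup>2\<close>.\<close>

lemma inner_inverse: "inner a (1 / w) * (norm w)\<^sup>2 = inner (cnj a) w" for w :: complex
proof (cases "w = 0")
  case False
  have "1 / w = cnj w / (norm w)\<^sup>2"
    using False by (simp add: complex_div_cnj[of 1 w])
  then have "1 / w = (1 / (norm w)\<^sup>2) *\<^sub>R cnj w"
    by (simp add: scaleR_conv_of_real)
  then have "inner a (1 / w) = (1 / (norm w)\<^sup>2) * inner a (cnj w)"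
    by (metis inner_scaleR_right)
  then show ?thesis using False by (simp add: inner_complex_def)
qed simp

text \<open>Multiplication by \<open>(norm w)\<^sup>2\<close> reverses the coefficients 1, 2, 2 of
  the quadratic inequality for \<open>unit_disc\<close>, giving those of
  \<open>small_disc\<close>.\<close>

lemma unit_disc_inverse:
  assumes "a \<in> min_J" "w \<noteq> 0" "1 / w \<in> unit_disc a"
  shows "norm (w + cnj a / 2) \<le> 1 / 2"
proof -
  have "((norm (1/w))\<^sup>2 + 2 * inner a (1/w) + 2) * (norm w)\<^sup>2 \<le> 0"
    using assms by (intro mult_nonpos_nonneg) (auto simp: unit_disc_iff)
  then have "1 + 2 * inner (cnj a) w + 2 * (norm w)\<^sup>2 \<le> 0"
    unfolding distrib_right norm_inverse_sq[OF assms(2)] mult.assoc inner_inverse by simp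
  then have "(norm (w + cnj a / 2))\<^sup>2 \<le> (1 / 2)\<^sup>2" using assms(1)
    by (simp add: norm_add_sq min_J_def norm_divide power_divide inner_commute inner_half)
  then show ?thesis by (rule power2_le_imp_le) simp
qed

lemma small_disc_inverse:
  assumes "a \<in> min_J" "w \<noteq> 0" "1 / w \<in> small_disc a"
  shows "norm (w + cnj a) \<le> 1"
proof -
  have "(2 * (norm (1/w))\<^sup>2 + 2 * inner a (1/w) + 1) * (norm w)\<^sup>2 \<le> 0"
    using assms by (intro mult_nonpos_nonneg) (auto simp: small_disc_iff)
  then have "2 * 1 + 2 * inner (cnj a) w + (norm w)\<^sup>2 \<le> 0"
    unfolding distrib_right norm_inverse_sq[OF assms(2)] mult.assoc inner_inverse by simp
  then show ?thesis using assms
    by (simp add: norm_le_sq_iff norm_add_sq min_J_def inner_commute)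
qed

text \<open>\<open>d\<close> lies within distance less than 3/2 of the midpoint of 0 and
  \<open>- cnj a\<close>, while all lattice points other than these two are at least 3/2 away from
  it.\<close>

lemma unit_disc_backward:
  assumes "a \<in> min_J" "norm v < 1" "d \<in> ideal_J" "d \<noteq> 0" "d + v \<noteq> 0" "1 / (d + v) \<in> unit_disc a"
  shows "d = - cnj a" "v \<in> small_disc d"
proof -
  have *: "norm (v + (d + cnj a / 2)) \<le> 1 / 2"
    using unit_disc_inverse[OF assms(1,5,6)] by (simp add: algebra_simps)
  show d: "d = - cnj a"
  proof (rule ccontr)
    assume "d \<noteq> - cnj a"
    then have "d + cnj a \<noteq> 0" by (metis add_eq_0_iff2)
    then have "3 \<le> (norm (d + cnj a))\<^sup>2"
      using assms by (intro ideal_J_norm_ge ideal_J_add ideal_J_cnj) (auto simp: min_J_def)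
    moreover have "3 \<le> (norm d)\<^sup>2" using assms by (intro ideal_J_norm_ge)
    \<comment> \<open>By the parallelogram law the square is at least
      \<open>(3 + 3) / 2 - 3 / 4\<close>.\<close>
    ultimately have "(3 / 2)\<^sup>2 \<le> (norm (d + cnj a / 2))\<^sup>2"
      using assms(1) by (simp add: norm_add_sq min_J_def norm_divide power_divide inner_half)
    then have "3 / 2 \<le> norm (d + cnj a / 2)" by (rule power2_le_imp_le) simp
    then show False
      using * assms(2) norm_triangle_ineq4[of "v + (d + cnj a / 2)" v] by simp
  qed
  show "v \<in> small_disc d" using * unfolding small_disc_def by (simp add: d algebra_simps)
qed

text \<open>\<open>d + cnj a\<close> is a lattice vector of norm less than 2, hence 0 or
  minimal.\<close>

lemma small_disc_backward:
  assumes "a \<in> min_J" "norm v < 1" "d \<in> ideal_J" "d + v \<noteq> 0" "1 / (d + v) \<in> small_disc a"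
  shows "d = - cnj a \<or> d + cnj a \<in> min_J \<and> v \<in> unit_disc (d + cnj a)"
proof (cases "d + cnj a = 0")
  case True then show ?thesis by (metis add_eq_0_iff2)
next
  case False
  have *: "norm (v + (d + cnj a)) \<le> 1"
    using small_disc_inverse[OF assms(1,4,5)] by (simp add: algebra_simps)
  then have "norm (d + cnj a) < 2"
    using assms(2) norm_triangle_ineq4[of "v + (d + cnj a)" v] by simp
  then have "(norm (d + cnj a))\<^sup>2 < 2\<^sup>2" by (intro power_strict_mono) auto
  moreover have "d + cnj a \<in> ideal_J" using assms by (intro ideal_J_add ideal_J_cnj) (auto simp: min_J_def)
  ultimately have "d + cnj a \<in> min_J" using ideal_J_norm[of "d + cnj a"] False by (auto simp: min_J_def)
  then show ?thesis using * by (simp add: unit_disc_def)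
qed

section \<open>Compatibility along one step\<close>

lemma compatible_unit_disc:
  assumes "compatible x v" "a \<in> min_J" "v \<in> unit_disc a" "x \<noteq> 0"
  shows "inner a (1 / x) \<le> 3 / 2"
proof -
  have "inner a (1 / x) * (norm x)\<^sup>2 \<le> (3 / 2) * (norm x)\<^sup>2"
    using assms by (auto simp: compatible_def inner_inverse)
  then show ?thesis using assms(4) by (simp add: mult_le_cancel_right)
qed

lemma compatible_step:
  assumes "compatible x v" "norm v < 1" "x \<noteq> 0"
    and hex: "\<And>a. a \<in> min_J \<Longrightarrow> - (3 / 2) \<le> inner a x"
    and d: "d \<in> ideal_J" "d \<noteq> 0" "d + v \<noteq> 0"
  shows "compatible (1 / x - d) (1 / (d + v))"
  unfolding compatible_def
proof (intro conjI ballI impI)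
  let ?y = "1 / x"
  have pos: "0 < (norm x)\<^sup>2" using assms(3) by simp
  {
    \<comment> \<open>The circle of radius \<open>1 / sqrt 3\<close> about
      \<open>2 cnj d / 3\<close> is orthogonal to the unit circle, so inversion takes it to the one
      about \<open>2 d / 3\<close>; subtracting \<open>d = - cnj a\<close> moves the centre to
      \<open>cnj a / 3\<close>.\<close>
    fix a assume a: "a \<in> min_J" and L: "1 / (d + v) \<in> unit_disc a"
    note h = unit_disc_backward[OF a assms(2) d L]
    have "d \<in> min_J" using h(1) min_J_cnj[OF a] by simp
    then have "4 * inner (cnj d) x \<le> 3 * (norm x)\<^sup>2 + 3"
      using h(2) assms(1) by (auto simp: compatible_def)
    then have "0 \<le> 3 * (norm x)\<^sup>2 - 4 * inner (cnj d) x + 3" by simp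
    also have "\<dots> = (3 * (norm ?y)\<^sup>2 - 4 * inner d ?y + 3) * (norm x)\<^sup>2"
      unfolding distrib_right left_diff_distrib mult.assoc norm_inverse_sq[OF assms(3)] inner_inverse
      by simp
    finally have "0 \<le> 3 * (norm ?y)\<^sup>2 - 4 * inner d ?y + 3" using pos by (simp add: zero_le_mult_iff)
    moreover have "cnj a = - d" "(norm d)\<^sup>2 = 3" using h(1) a by (auto simp: min_J_def)
    ultimately show "2 * inner (cnj a) (?y - d) \<le> 3 * (norm (?y - d))\<^sup>2"
      by (simp add: norm_diff_sq inner_diff_right inner_commute power2_norm_eq_inner[of d, symmetric])
  }
  {
    fix a assume a: "a \<in> min_J" and P: "1 / (d + v) \<in> small_disc a"
    let ?z = "?y - d"
    have na: "(norm a)\<^sup>2 = 3" using a by (simp add: min_J_def)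
    from small_disc_backward[OF a assms(2) d(1,3) P]
    show "4 * inner (cnj a) ?z \<le> 3 * (norm ?z)\<^sup>2 + 3"
    proof (elim disjE conjE)
      \<comment> \<open>Here the hexagon suffices: the half-plane
        \<open>inner a x \<ge> - (3 / 2)\<close> inverts to the outside of the disc about
        \<open>- cnj a / 3\<close>, and subtracting \<open>d\<close> moves the centre to
        \<open>2 cnj a / 3\<close>.\<close>
      assume ba: "d = - cnj a"
      have "0 \<le> 3 + 2 * inner a x" using hex[OF a] by simp
      also have "\<dots> = (3 * (norm ?y)\<^sup>2 + 2 * inner (cnj a) ?y) * (norm x)\<^sup>2"
        unfolding distrib_right mult.assoc norm_inverse_sq[OF assms(3)] inner_inverse by simp
      finally have "0 \<le> 3 * (norm ?y)\<^sup>2 + 2 * inner (cnj a) ?y" using pos by (simp add: zero_le_mult_iff)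
      then show ?thesis using na
        by (simp add: ba norm_add_sq inner_add_right inner_commute power2_norm_eq_inner[of "cnj a", symmetric])
    next
      \<comment> \<open>Here \<open>1 / x\<close> lies in a half-plane bounded by a bisector; its
        translate by \<open>- d\<close> misses the open disc about \<open>2 cnj a / 3\<close>. The
        vector \<open>t\<close> below is 3 times the displacement from that centre.\<close>
      assume c: "d + cnj a \<in> min_J" "v \<in> unit_disc (d + cnj a)"
      define c where "c = d + cnj a"
      have c: "c \<in> min_J" "v \<in> unit_disc c" "d = c - cnj a" using c by (auto simp: c_def)
      have nc: "(norm c)\<^sup>2 = 3" using c by (simp add: min_J_def)
      have "3 \<le> (norm d)\<^sup>2" using d by (intro ideal_J_norm_ge)
      then have "inner c (cnj a) \<le> 3 / 2" using nc na by (simp add: c(3) norm_diff_sq)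
      moreover have "inner c ?z \<le> inner c (cnj a) - 3 / 2"
        using compatible_unit_disc[OF assms(1) c(1,2) assms(3)] nc
        by (simp add: c(3) inner_diff_right power2_norm_eq_inner)
      moreover define t where "t = 3 *\<^sub>R ?z - 2 *\<^sub>R cnj a"
      have "inner c t = 3 * inner c ?z - 2 * inner c (cnj a)"
        by (simp only: t_def inner_diff_right[of c "3 *\<^sub>R ?z"] inner_scaleR_right)
      ultimately have "3 \<le> - inner c t" by linarith
      also have "\<dots> \<le> norm c * norm t" using Cauchy_Schwarz_ineq2[of c t] by linarith
      finally have "3\<^sup>2 \<le> (norm c * norm t)\<^sup>2" by (intro power_mono) auto
      then have "3 \<le> (norm t)\<^sup>2" using nc by (simp add: power_mult_distrib)
      also have "(norm t)\<^sup>2 = 9 * (norm ?z)\<^sup>2 - 12 * inner (cnj a) ?z + 4 * 3"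
        unfolding t_def norm_diff_sq[of "3 *\<^sub>R ?z"]
        by (simp only: norm_scaleR inner_scaleR_left inner_scaleR_right power_mult_distrib
            complex_mod_cnj na) (simp add: inner_commute)
      finally show ?thesis by simp
    qed
  }
qed

lemma small_denominator:
  assumes "d \<in> ideal_J" "d \<noteq> 0" "norm v < 1" "norm (d + v) \<le> 1"
  shows "d \<in> min_J" "v \<in> unit_disc d"
proof -
  have "norm d < 2" using assms norm_triangle_ineq4[of "d + v" v] by simp
  then have "(norm d)\<^sup>2 < 2\<^sup>2" by (intro power_strict_mono) auto
  then show "d \<in> min_J" using ideal_J_norm[OF assms(1,2)] assms(1) by (auto simp: min_J_def)
  show "v \<in> unit_disc d" using assms by (simp add: unit_disc_def add.commute)
qed

text \<open>Otherwise \<open>1 / x\<close>, which is within distance 1 of \<open>d\<close>, would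
  lie on the side of the bisector of 0 and \<open>d\<close> that contains 0, so \<open>1 / x\<close>
  would have norm at most 1.\<close>

lemma compatible_denominator:
  assumes "compatible x v" "norm v < 1" "x \<noteq> 0" "norm x < 1"
    and d: "d \<in> ideal_J" "d \<noteq> 0" "1 / x - d \<in> fund_dom"
  shows "1 < norm (d + v)"
proof (rule ccontr)
  assume "\<not> 1 < norm (d + v)"
  then have m: "d \<in> min_J" "v \<in> unit_disc d" using small_denominator[OF d(1,2) assms(2)] by auto
  let ?z = "1 / x - d"
  have "norm ?z \<le> 1"
    using fund_dom_norm[OF d(3)] norm_exceptional[of ?z] by force
  then have "(norm ?z)\<^sup>2 \<le> 1" by (simp add: power_le_one)
  moreover have "inner d (1 / x) \<le> 3 / 2" by (rule compatible_unit_disc[OF assms(1) m assms(3)])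
  moreover have nb: "(norm d)\<^sup>2 = 3" using m by (simp add: min_J_def)
  ultimately have "(norm (1 / x))\<^sup>2 \<le> 1"
    by (simp add: norm_diff_sq inner_commute)
  moreover have "- (3 / 2) \<le> inner d ?z" by (rule fund_dom_inner[OF d(3) m(1)])
  moreover have "1 < norm (1 / x)" using assms(3,4) by (simp add: norm_divide)
  then have "1\<^sup>2 < (norm (1 / x))\<^sup>2" by (intro power_strict_mono) auto
  ultimately show False by simp
qed

lemma unit_disc_subset_small_disc:
  assumes "a \<in> min_J" "norm v < 1" "v \<in> unit_disc a"
  shows "v \<in> small_disc a"
proof -
  have "(norm v)\<^sup>2 \<le> 1" using assms(2) by (simp add: power_le_one)
  then show ?thesis using assms by (simp add: unit_disc_iff small_disc_iff)
qed

lemma not_small_disc_0: "a \<in> min_J \<Longrightarrow> 0 \<notin> small_disc a"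
  by (simp add: small_disc_iff)

text \<open>For the step into an exceptional vertex, with \<open>a = sqrt_m3\<close>. Either
  \<open>1 / x\<close> itself is the given number of norm 1, or \<open>1 / x\<close> is at distance
  1 from some \<open>c\<close> and no farther from 0; both contradict
  \<open>norm x < 1\<close>.\<close>

lemma compatible_not_small_disc:
  assumes "compatible x v" "norm v < 1" "x \<noteq> 0" "norm x < 1" "d \<in> ideal_J" "d + v \<noteq> 0"
    and a: "a \<in> min_J" "norm (1 / x - d - cnj a) = 1"
  shows "1 / (d + v) \<notin> small_disc a"
proof
  have gt: "1 < norm (1 / x)" using assms(3,4) by (simp add: norm_divide)
  assume "1 / (d + v) \<in> small_disc a"
  from small_disc_backward[OF a(1) assms(2,5,6) this] show False
  proof (elim disjE conjE)
    assume "d = - cnj a"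
    then show False using a gt by simp
  next
    define c where "c = d + cnj a"
    define u where "u = 1 / x - d - cnj a"
    assume "d + cnj a \<in> min_J" "v \<in> unit_disc (d + cnj a)"
    then have c: "c \<in> min_J" "v \<in> unit_disc c" by (simp_all add: c_def)
    have x: "1 / x = u + c" by (simp add: u_def c_def)
    have cc: "(norm c)\<^sup>2 = 3" using c by (simp add: min_J_def)
    have "inner c (1 / x) \<le> 3 / 2" by (rule compatible_unit_disc[OF assms(1) c assms(3)])
    then have "inner u c \<le> - (3 / 2)"
      using cc by (simp add: x inner_add_right inner_commute power2_norm_eq_inner)
    then have "(norm (1 / x))\<^sup>2 \<le> 1\<^sup>2"
      using cc a(2)[folded u_def] unfolding x norm_add_sq by simp
    moreover have "1\<^sup>2 < (norm (1 / x))\<^sup>2" using gt by (intro power_strict_mono) auto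
    ultimately show False by simp
  qed
qed

section \<open>Growth of the denominators\<close>

lemma digits_in_min_J: "sqrt_m3 \<in> min_J" "eta \<in> min_J" "- cnj eta \<in> min_J"
proof -
  have "sqrt_m3 \<in> ideal_J"
    unfolding ideal_J_iff by (intro exI[of _ 0] exI[of _ 1]) simp
  moreover have "eta \<in> ideal_J"
    unfolding ideal_J_iff by (intro exI[of _ 1] exI[of _ 0]) simp
  ultimately show "sqrt_m3 \<in> min_J" "eta \<in> min_J"
    by (simp_all add: min_J_def norm_coord)
  then show "- cnj eta \<in> min_J" by (simp add: min_J_cnj)
qed

lemma b_exc_in_min_J: "b_exc \<xi> k \<in> min_J"
  using digits_in_min_J by (simp add: b_exc_def)

text \<open>Index \<open>i + 3\<close> is where growth would fail, and the hypothesis is what one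
  backward step then requires. It holds only for odd \<open>i\<close>; the inequalities exclude the
  continuations two and three steps back.\<close>

lemma b_exc_pattern:
  assumes "\<xi> \<in> {- zeta, cnj zeta}" "b_exc \<xi> (i + 2) = - cnj (b_exc \<xi> (i + 3))"
  shows "0 < i" "b_exc \<xi> (i + 1) \<noteq> b_exc \<xi> (i + 3)"
    "b_exc \<xi> i \<noteq> - cnj (b_exc \<xi> (i + 1) - b_exc \<xi> (i + 3))"
proof -
  have ne: "cnj zeta \<noteq> - zeta" by (simp add: complex_eq_coord)
  define r where "r = i mod 4"
  have "(i + 1) mod 4 = (r + 1) mod 4" "(i + 2) mod 4 = (r + 2) mod 4"
    "(i + 3) mod 4 = (r + 3) mod 4" "i mod 4 = r" "r \<in> {0, 1, 2, 3}"
    unfolding r_def insert_iff empty_iff by presburger+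
  then have e: "r \<in> {0, 1, 2, 3}" "b_exc \<xi> i = b_exc \<xi> r" "b_exc \<xi> (i + 1) = b_exc \<xi> (r + 1)"
    "b_exc \<xi> (i + 2) = b_exc \<xi> (r + 2)" "b_exc \<xi> (i + 3) = b_exc \<xi> (r + 3)"
    by (auto simp: b_exc_def)
  have r: "r = 1 \<or> r = 3"
    using e(1) assms ne unfolding e by (auto simp: b_exc_def complex_eq_coord)
  then show "0 < i" by (auto simp: r_def intro: ccontr)
  show "b_exc \<xi> (i + 1) \<noteq> b_exc \<xi> (i + 3)"
    "b_exc \<xi> i \<noteq> - cnj (b_exc \<xi> (i + 1) - b_exc \<xi> (i + 3))"
    unfolding e using r assms(1) ne by (auto simp: b_exc_def complex_eq_coord)
qed

text \<open>By the index shift this is \<open>q_{n-1} / q_n\<close>, with value 0 at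
  \<open>n = 0\<close>.\<close>

definition q_ratio :: "complex \<Rightarrow> nat \<Rightarrow> complex" where
  "q_ratio z n = q_shifted n z / q_shifted (Suc n) z"

definition q_increase :: "complex \<Rightarrow> nat \<Rightarrow> bool" where
  "q_increase z n \<longleftrightarrow> norm (q_shifted n z) < norm (q_shifted (Suc n) z)"

lemma q_increase_0: "q_increase z 0"
  by (simp add: q_increase_def)

lemma norm_q_ratio: "q_increase z n \<Longrightarrow> norm (q_ratio z n) < 1"
  by (auto simp: q_increase_def q_ratio_def norm_divide divide_less_eq)

lemma q_shifted_ratio:
  assumes "q_increase z n"
  shows "q_shifted (Suc (Suc n)) z = q_shifted (Suc n) z * (b (Suc n) z + q_ratio z n)"
proof -
  have "q_shifted (Suc n) z \<noteq> 0" using assms by (auto simp: q_increase_def)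
  then show ?thesis by (simp add: q_ratio_def field_simps)
qed

lemma q_increase_Suc:
  assumes "q_increase z n"
  shows "q_increase z (Suc n) \<longleftrightarrow> 1 < norm (b (Suc n) z + q_ratio z n)"
proof -
  have "0 < norm (q_shifted (Suc n) z)" using assms by (auto simp: q_increase_def)
  then show ?thesis
    unfolding q_increase_def q_shifted_ratio[OF assms] norm_mult by simp
qed

lemma q_ratio_Suc:
  assumes "q_increase z n"
  shows "q_ratio z (Suc n) = 1 / (b (Suc n) z + q_ratio z n)"
proof -
  have "q_shifted (Suc n) z \<noteq> 0" using assms by (auto simp: q_increase_def)
  then show ?thesis
    unfolding q_ratio_def[of z "Suc n"] q_shifted_ratio[OF assms] by simp
qed

lemma denominator_nonzero:
  assumes "q_increase z n" "q_increase z (Suc n)"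
  shows "b (Suc n) z + q_ratio z n \<noteq> 0"
  using assms q_increase_Suc by force

section \<open>Orbits of \<open>T\<close> and their partial quotients\<close>

lemma T_fund_dom: "x \<in> fund_dom \<Longrightarrow> T x \<in> fund_dom"
  using J_part_props(2)[of "1 / x"] by (cases "x = 0") (simp_all add: T_def)

lemma T_pow_fund_dom: "z \<in> fund_dom \<Longrightarrow> (T ^^ n) z \<in> fund_dom"
  by (induction n) (auto intro: T_fund_dom)

text \<open>0 is a fixed point of \<open>T\<close>.\<close>

lemma T_pow_nonzero: "(T ^^ n) z \<noteq> 0 \<Longrightarrow> j \<le> n \<Longrightarrow> (T ^^ j) z \<noteq> 0"
proof (induction n)
  case (Suc n)
  then have "T ((T ^^ n) z) \<noteq> 0" by simp
  then have "(T ^^ n) z \<noteq> 0" unfolding T_def[of "(T ^^ n) z"] by metis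
  then show ?case using Suc by (cases "j = Suc n") auto
qed simp

lemma b_regular:
  assumes "\<And>j. j \<le> n \<Longrightarrow> (T ^^ j) z \<notin> {- zeta, cnj zeta}"
  shows "b (Suc n) z = J_part (1 / (T ^^ n) z)"
  using assms unfolding b_def by (auto simp: less_Suc_eq_le)

lemma b_exceptional:
  assumes "(T ^^ m) z \<in> {- zeta, cnj zeta}" "\<And>j. j < m \<Longrightarrow> (T ^^ j) z \<notin> {- zeta, cnj zeta}"
  shows "b (Suc (m + k)) z = b_exc ((T ^^ m) z) (Suc k)"
proof -
  have "(LEAST j. (T ^^ j) z \<in> {- zeta, cnj zeta}) = m"
    using assms by (intro Least_equality) (auto simp: not_le[symmetric])
  moreover have "\<exists>j<Suc (m + k). (T ^^ j) z \<in> {- zeta, cnj zeta}"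
    using assms(1) by (intro exI[of _ m]) auto
  ultimately show ?thesis unfolding b_def by simp
qed

lemma J_part_nonzero:
  assumes "x \<noteq> 0" "norm x < 1"
  shows "J_part (1 / x) \<noteq> 0"
proof
  assume "J_part (1 / x) = 0"
  then have "1 / x \<in> fund_dom" using J_part_props(2)[of "1 / x"] by simp
  then have "norm (1 / x) \<le> 1"
    using fund_dom_norm[of "1 / x"] norm_exceptional[of "1 / x"] by force
  then show False using assms by (simp add: norm_divide)
qed

text \<open>Only the points before time \<open>n\<close> are restricted, so the conclusion still
  covers the first visit to an exceptional vertex.\<close>

lemma regular_phase:
  assumes "z \<in> fund_dom"
    and "\<And>j. j < n \<Longrightarrow> (T ^^ j) z \<noteq> 0 \<and> (T ^^ j) z \<notin> {- zeta, cnj zeta}"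
  shows "q_increase z n \<and> compatible ((T ^^ n) z) (q_ratio z n)"
  using assms(2)
proof (induction n)
  case 0
  \<comment> \<open>The initial ratio 0 lies in none of the discs.\<close>
  then show ?case
    by (simp add: q_increase_0 compatible_def q_ratio_def unit_disc_iff small_disc_iff)
next
  case (Suc n)
  define x where "x = (T ^^ n) z"
  define d where "d = J_part (1 / x)"
  have IH: "q_increase z n" "compatible x (q_ratio z n)" using Suc by (auto simp: x_def)
  have x: "x \<in> fund_dom" "x \<noteq> 0" "x \<notin> {- zeta, cnj zeta}"
    using Suc.prems[of n] T_pow_fund_dom[OF assms(1)] by (auto simp: x_def)
  note nx = fund_dom_norm[OF x(1,3)] and v = norm_q_ratio[OF IH(1)]
  have d: "d \<in> ideal_J" "d \<noteq> 0" "1 / x - d \<in> fund_dom"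
    using J_part_props J_part_nonzero[OF x(2) nx] by (auto simp: d_def)
  have bd: "b (Suc n) z = d" unfolding d_def x_def by (rule b_regular) (use Suc.prems in auto)
  have big: "1 < norm (d + q_ratio z n)"
    by (rule compatible_denominator[OF IH(2) v x(2) nx d])
  have "(T ^^ Suc n) z = 1 / x - d" using x(2) by (simp add: T_def x_def d_def)
  moreover have "compatible (1 / x - d) (1 / (d + q_ratio z n))"
    using big by (intro compatible_step[OF IH(2) v x(2)] fund_dom_inner[OF x(1)] d) auto
  ultimately show ?case
    using big q_increase_Suc[OF IH(1)] q_ratio_Suc[OF IH(1)] by (simp add: bd)
qed

lemma exceptional_phase:
  assumes "z \<in> fund_dom"
    and m: "(T ^^ m) z \<in> {- zeta, cnj zeta}" "\<And>j. j < m \<Longrightarrow> (T ^^ j) z \<notin> {- zeta, cnj zeta}"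
  shows "q_increase z (m + k)"
proof -
  define \<xi> where "\<xi> = (T ^^ m) z"
  have \<xi>: "\<xi> \<in> {- zeta, cnj zeta}" using m by (simp add: \<xi>_def)
  have "(T ^^ m) z \<noteq> 0" using norm_exceptional[OF m(1)] by force
  then have nz: "(T ^^ j) z \<noteq> 0" if "j \<le> m" for j using T_pow_nonzero that by blast
  have reg: "q_increase z j" "compatible ((T ^^ j) z) (q_ratio z j)" if "j \<le> m" for j
    using regular_phase[OF assms(1), of j] nz m(2) that by auto
  have D: "b (Suc (m + i)) z = b_exc \<xi> (Suc i)" for i
    unfolding \<xi>_def by (rule b_exceptional[OF m])
  have nE: "b_exc \<xi> i \<noteq> 0" "b_exc \<xi> i \<in> ideal_J" for i
    using b_exc_in_min_J[of \<xi> i] by (auto simp: min_J_def)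
  \<comment> \<open>The first two exceptional partial quotients are \<open>sqrt_m3\<close>, so
    failure at either would put the entry ratio into this disc.\<close>
  have entry: "q_ratio z m \<notin> small_disc sqrt_m3"
  proof (cases m)
    case 0 then show ?thesis by (simp add: q_ratio_def not_small_disc_0 digits_in_min_J)
  next
    case (Suc l)
    define x where "x = (T ^^ l) z"
    have x: "x \<noteq> 0" "norm x < 1"
      using nz[of l] fund_dom_norm[OF T_pow_fund_dom[OF assms(1)] m(2)[of l]] Suc
      by (auto simp: x_def)
    have bl: "b (Suc l) z = J_part (1 / x)"
      unfolding x_def by (rule b_regular) (use m(2) Suc in auto)
    have q: "q_increase z l" "q_increase z (Suc l)" using reg Suc by auto
    have "\<xi> = 1 / x - J_part (1 / x)" using x(1) Suc by (simp add: \<xi>_def x_def T_def)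
    moreover have "(norm (\<xi> - cnj sqrt_m3))\<^sup>2 = 1" using \<xi> by (auto simp: norm_coord)
    then have "norm (\<xi> - cnj sqrt_m3) = 1"
      using power2_eq_1_iff[of "norm (\<xi> - cnj sqrt_m3)"] norm_ge_zero[of "\<xi> - cnj sqrt_m3"] by linarith
    ultimately show ?thesis
      unfolding Suc q_ratio_Suc[OF q(1)] bl
      using reg[of l] Suc x J_part_props denominator_nonzero[OF q] digits_in_min_J(1)
      by (intro compatible_not_small_disc[of x]) (auto simp: x_def[symmetric] bl norm_q_ratio)
  qed
  show ?thesis
  proof (induction k rule: less_induct)
    case (less k)
    show ?case
    proof (cases k)
      case 0 then show ?thesis using reg by simp
    next
      case (Suc k')
      define r where "r i = q_ratio z (m + i)" for i
      define e where "e = b_exc \<xi>"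
      have inc: "q_increase z (m + i)" if "i \<le> k'" for i using less that Suc by simp
      have nr: "norm (r i) < 1" if "i \<le> k'" for i
        unfolding r_def by (rule norm_q_ratio[OF inc[OF that]])
      have rS: "r (Suc i) = 1 / (e (Suc i) + r i)" "e (Suc i) + r i \<noteq> 0" if "Suc i \<le> k'" for i
        using q_ratio_Suc[OF inc[of i]] denominator_nonzero[OF inc[of i]] inc[of "Suc i"] that
        by (simp_all add: r_def e_def D)
      have e: "e i \<in> min_J" "e i \<in> ideal_J" "e i \<noteq> 0" for i
        using b_exc_in_min_J nE by (auto simp: e_def)
      have step_back: "e (Suc i) = - cnj a \<and> r i \<in> small_disc (e (Suc i))"
        if "Suc i \<le> k'" "a \<in> min_J" "r (Suc i) \<in> unit_disc a" for a i
        using unit_disc_backward[OF that(2) nr e(2,3) rS(2)] that rS(1)[of i] by simp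
      have "1 < norm (e (Suc k') + r k')"
      proof (rule ccontr)
        assume "\<not> 1 < norm (e (Suc k') + r k')"
        then have L: "r k' \<in> unit_disc (e (Suc k'))"
          using small_denominator(2)[OF e(2,3) nr] by simp
        \<comment> \<open>Up to three backward steps are available, depending on the time since
          entry.\<close>
        consider "k' = 0" | "k' = 1" | i where "k' = i + 2"
          by (metis One_nat_def add_2_eq_Suc' not0_implies_Suc)
        then show False
        proof cases
          case 1
          then have "r 0 \<in> small_disc sqrt_m3"
            using unit_disc_subset_small_disc[OF e(1) nr L] by (simp add: e_def b_exc_def)
          then show False using entry by (simp add: r_def)
        next
          case 2
          then have "r 0 \<in> small_disc sqrt_m3"
            using step_back[of 0 sqrt_m3] L digits_in_min_J(1) by (simp add: e_def b_exc_def)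
          then show False using entry by (simp add: r_def)
        next
          case 3
          have "e (Suc (Suc i)) = - cnj (e (i + 3)) \<and> r (Suc i) \<in> small_disc (e (Suc (Suc i)))"
            by (rule step_back) (use L 3 e(1) in \<open>simp_all add: numeral_eq_Suc\<close>)
          then have h: "e (i + 2) = - cnj (e (i + 3))" "r (Suc i) \<in> small_disc (e (i + 2))"
            unfolding add_2_eq_Suc' by blast+
          note pat = b_exc_pattern[OF \<xi> h(1)[unfolded e_def], folded e_def]
          have "e (Suc i) = - cnj (e (i + 2))
              \<or> e (Suc i) + cnj (e (i + 2)) \<in> min_J \<and> r i \<in> unit_disc (e (Suc i) + cnj (e (i + 2)))"
            using small_disc_backward[OF e(1) nr e(2) rS(2)] h(2) rS(1)[of i] 3 by simp
          \<comment> \<open>Since \<open>cnj (e (i + 2)) = - e (i + 3)\<close>, the first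
            alternative reads \<open>e (i + 1) = e (i + 3)\<close>, which the pattern
            forbids.\<close>
          then have c: "e (i + 1) - e (i + 3) \<in> min_J" "r i \<in> unit_disc (e (i + 1) - e (i + 3))"
            using h(1) pat(2) by auto
          obtain l where l: "i = Suc l" using pat(1) by (cases i) auto
          \<comment> \<open>A third backward step would force the value of \<open>e i\<close> that
            the pattern excludes.\<close>
          show False using step_back[of l, OF _ c(1)] c(2) pat(3) 3 l by simp
        qed
      qed
      then show ?thesis
        using q_increase_Suc[OF inc[of k']] by (simp add: Suc D r_def e_def)
    qed
  qed
qed

theorem theorem4:
  fixes z :: complex and n :: nat
  assumes "z \<in> fund_dom" and "n \<ge> 1" and "(T ^^ n) z \<noteq> 0"
  shows "norm (q n z) < norm (q (n + 1) z)"
proof -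
  have "q_increase z (Suc n)"
  \<comment> \<open>A visit up to time \<open>n\<close> already determines the partial quotient of
    index \<open>n + 1\<close>; without one the regular phase reaches \<open>Suc n\<close>.\<close>
  proof (cases "\<exists>j\<le>n. (T ^^ j) z \<in> {- zeta, cnj zeta}")
    case True
    define m where "m = (LEAST j. (T ^^ j) z \<in> {- zeta, cnj zeta})"
    obtain j where "j \<le> n" "(T ^^ j) z \<in> {- zeta, cnj zeta}" using True by blast
    then have "(T ^^ m) z \<in> {- zeta, cnj zeta}" "m \<le> n"
      unfolding m_def
      using LeastI[of "\<lambda>j. (T ^^ j) z \<in> {- zeta, cnj zeta}" j]
        Least_le[of "\<lambda>j. (T ^^ j) z \<in> {- zeta, cnj zeta}" j] by linarith+
    moreover have "(T ^^ j) z \<notin> {- zeta, cnj zeta}" if "j < m" for j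
      using not_less_Least[OF that[unfolded m_def]] .
    ultimately show ?thesis
      using exceptional_phase[OF assms(1), of m "Suc n - m"] by simp
  next
    case False
    then show ?thesis
      using regular_phase[OF assms(1), of "Suc n"] T_pow_nonzero[OF assms(3)]
      by (auto simp: less_Suc_eq_le)
  qed
  then show ?thesis by (simp add: q_increase_def q_def)
qed

end
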